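(* Let $G$ be a finitely generated infinite group. If $G$ has one end, has undistorted elements (i.e. contains an undistorted element), and its divergence function grows sub-exponentially, then $G\in\mathcal{G}_H$.
   Context: Fix a finite symmetric generating set $S$ of $G$ with word length $\ell_S$, and let $B(n)=\{g\in G:\ell_S(g)\le n\}$. For a finite (discrete) set $A$, $G$ acts on $A^G$ (product topology) by $(gx)_h=x_{g^{-1}h}$ (the full shift). **The class $\mathcal{G}_H$.** $\mathscr{G}_{inv}$ is the class of Polish groups admitting a compatible bi-invariant metric; for $H\in\mathscr{G}_{inv}$ fix such a (complete) metric $d$. A map $f:A^G\to H$ is H\"older continuous if there are $C>0$, $0<r<1$ such that for every $n\ge0$, $d(f(x),f(y))\le Cr^n$ for all $x,y$ with $x_{B(n)}=y_{B(n)}$. A cocycle $c:G\times A^G\to H$ is a map with $c(gh,x)=c(g,hx)c(h,x)$; it is H\"older continuous if $c(g,\cdot)$ is H\"older continuous for each $g\in G$. Cocycles $c_1,c_2$ are H\"older cohomologous if there is a H\"older continuous $b:A^G\to H$ with $c_1(g,x)=b(gx)^{-1}c_2(g,x)b(x)$ for all $g,x$. $\mathcal{G}_H$ is the class of groups $G$ such that for every finite set $A$ and every $H\in\mathscr{G}_{inv}$, every H\"older continuous cocycle $c:G\times A^G\to H$ is H\"older cohomologous to a group homomorphism $G\to H$ (viewed as a cocycle independent of $x$). **Undistorted elements.** $g\in G$ of infinite order is undistorted if $\lim_{n\to\infty}\ell_S(g^n)/n>0$ (independent of $S$). **Divergence.** Let $Y$ be the Cayley graph of $G$ with respect to $S$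 with geodesic word metric $d_Y$. For $a,b\in Y$ and $c\in Y\setminus\{a,b\}$, the divergence of $a,b$ relative to $c$ is the length of the shortest path from $a$ to $b$ avoiding the ball around $c$ of radius $\min\{d_Y(c,a),d_Y(c,b)\}/2-2$ (infinite if there is no such path). $Div(a,b)$ is the supremum of these over $c\in Y\setminus\{a,b\}$, and $Div_Y(n)=\max\{Div(a,b):d_Y(a,b)\le n\}$. It grows sub-exponentially if $\lim_{n\to\infty}Div_Y(n)r^n=0$ for all $0<r<1$. *)

theory Defs
  imports
    "HOL-Analysis.Analysis"
    "HOL-Algebra.Generated_Groups"
    "HOL-Algebra.Multiplicative_Group"
begin

section \<open>Word length\<close>

definition finite_symmetric_generating_set :: "('g, 'm) monoid_scheme \<Rightarrow> 'g set \<Rightarrow> bool" where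
  "finite_symmetric_generating_set G S \<longleftrightarrow>
     finite S \<and> S \<subseteq> carrier G \<and> (\<forall>s\<in>S. inv\<^bsub>G\<^esub> s \<in> S) \<and> generate G S = carrier G"

definition word_length :: "('g, 'm) monoid_scheme \<Rightarrow> 'g set \<Rightarrow> 'g \<Rightarrow> nat" where
  "word_length G S g =
     (LEAST n. \<exists>ws. length ws = n \<and> set ws \<subseteq> S \<and> foldr (\<otimes>\<^bsub>G\<^esub>) ws \<one>\<^bsub>G\<^esub> = g)"

definition word_ball :: "('g, 'm) monoid_scheme \<Rightarrow> 'g set \<Rightarrow> nat \<Rightarrow> 'g set" where
  "word_ball G S n = {g \<in> carrier G. word_length G S g \<le> n}"

definition undistorted :: "('g, 'm) monoid_scheme \<Rightarrow> 'g set \<Rightarrow> 'g \<Rightarrow> bool" where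
  "undistorted G S g \<longleftrightarrow>
     g \<in> carrier G \<and> (\<forall>n::nat. n > 0 \<longrightarrow> g [^]\<^bsub>G\<^esub> n \<noteq> \<one>\<^bsub>G\<^esub>) \<and>
     (\<exists>L>0. (\<lambda>n::nat. real (word_length G S (g [^]\<^bsub>G\<^esub> n)) / real n) \<longlonglongrightarrow> L)"


section \<open>Cayley graph, ends and divergence\<close>

text \<open>
  The Cayley graph is given by its edge relation on the vertex set \<open>carrier G\<close>. Edges are
  \<open>{g, g s}\<close>, so that the word metric is left invariant; the relation is symmetric
  whenever \<open>S\<close> is.
\<close>

definition cayley_graph :: "('g, 'm) monoid_scheme \<Rightarrow> 'g set \<Rightarrow> 'g rel" where
  "cayley_graph G S = {(g, g \<otimes>\<^bsub>G\<^esub> s) | g s. g \<in> carrier G \<and> s \<in> S}"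

definition cayley_dist :: "('g, 'm) monoid_scheme \<Rightarrow> 'g set \<Rightarrow> 'g \<Rightarrow> 'g \<Rightarrow> nat" where
  "cayley_dist G S g h = word_length G S (inv\<^bsub>G\<^esub> g \<otimes>\<^bsub>G\<^esub> h)"

text \<open>Paths avoiding \<open>F\<close> are paths in the subgraph induced on the complement of \<open>F\<close>.\<close>

definition cayley_minus :: "('g, 'm) monoid_scheme \<Rightarrow> 'g set \<Rightarrow> 'g set \<Rightarrow> 'g rel" where
  "cayley_minus G S F = cayley_graph G S \<inter> (- F) \<times> (- F)"

definition components_minus :: "('g, 'm) monoid_scheme \<Rightarrow> 'g set \<Rightarrow> 'g set \<Rightarrow> 'g set set" where
  "components_minus G S F = {(cayley_minus G S F)\<^sup>* `` {a} | a. a \<in> carrier G - F}"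

text \<open>
  For an infinite group every finite \<open>F\<close> leaves at least one infinite component, since the
  Cayley graph is locally finite and connected; one end means that there is never a second.
\<close>

definition one_ended :: "('g, 'm) monoid_scheme \<Rightarrow> 'g set \<Rightarrow> bool" where
  "one_ended G S \<longleftrightarrow>
     (\<forall>F. finite F \<and> F \<subseteq> carrier G \<longrightarrow> (\<exists>!C. C \<in> components_minus G S F \<and> infinite C))"

text \<open>
  Balls are closed, as in \<^const>\<open>word_ball\<close>. The radius may be negative, in which case the ball is
  empty. The infimum over the empty set of lengths is \<open>\<infinity>\<close>.
\<close>

definition divergence_rel ::
    "('g, 'm) monoid_scheme \<Rightarrow> 'g set \<Rightarrow> 'g \<Rightarrow> 'g \<Rightarrow> 'g \<Rightarrow> enat" where
  "divergence_rel G S c a b =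
     (let \<rho> = real (min (cayley_dist G S c a) (cayley_dist G S c b)) / 2 - 2;
          B = {h \<in> carrier G. real (cayley_dist G S c h) \<le> \<rho>}
      in INF n \<in> {n. (a, b) \<in> cayley_minus G S B ^^ n}. enat n)"

definition divergence_pair :: "('g, 'm) monoid_scheme \<Rightarrow> 'g set \<Rightarrow> 'g \<Rightarrow> 'g \<Rightarrow> enat" where
  "divergence_pair G S a b = (SUP c \<in> carrier G - {a, b}. divergence_rel G S c a b)"

text \<open>
  A supremum in \<^typ>\<open>enat\<close>; it is attained whenever it is finite, the values being integers.
\<close>

definition divergence :: "('g, 'm) monoid_scheme \<Rightarrow> 'g set \<Rightarrow> nat \<Rightarrow> enat" where
  "divergence G S n =
     (SUP (a, b) \<in> {(a, b). a \<in> carrier G \<and> b \<in> carrier G \<and> cayley_dist G S a b \<le> n}.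
        divergence_pair G S a b)"

definition subexponential_divergence :: "('g, 'm) monoid_scheme \<Rightarrow> 'g set \<Rightarrow> bool" where
  "subexponential_divergence G S \<longleftrightarrow>
     (\<forall>r::real. 0 < r \<and> r < 1 \<longrightarrow>
        (\<lambda>n. ereal_of_enat (divergence G S n) * ereal (r ^ n)) \<longlonglongrightarrow> 0)"


section \<open>Polish groups with a bi-invariant metric\<close>

definition polish_group :: "('h, 'm) monoid_scheme \<Rightarrow> 'h topology \<Rightarrow> bool" where
  "polish_group H T \<longleftrightarrow>
     group H \<and> topspace T = carrier H \<and>
     continuous_map (prod_topology T T) T (\<lambda>(x, y). x \<otimes>\<^bsub>H\<^esub> y) \<and>
     continuous_map T T (\<lambda>x. inv\<^bsub>H\<^esub> x) \<and>
     separable_space T \<and> completely_metrizable_space T"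

text \<open>
  Completeness costs nothing: on a Polish group every compatible bi-invariant metric is
  complete.
\<close>

definition biinvariant_metric ::
    "('h, 'm) monoid_scheme \<Rightarrow> 'h topology \<Rightarrow> ('h \<Rightarrow> 'h \<Rightarrow> real) \<Rightarrow> bool" where
  "biinvariant_metric H T d \<longleftrightarrow>
     Metric_space (carrier H) d \<and> Metric_space.mtopology (carrier H) d = T \<and>
     Metric_space.mcomplete (carrier H) d \<and>
     (\<forall>x\<in>carrier H. \<forall>y\<in>carrier H. \<forall>z\<in>carrier H.
        d (z \<otimes>\<^bsub>H\<^esub> x) (z \<otimes>\<^bsub>H\<^esub> y) = d x y \<and> d (x \<otimes>\<^bsub>H\<^esub> z) (y \<otimes>\<^bsub>H\<^esub> z) = d x y)"


section \<open>Cocycles on the full shift\<close>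

definition full_shift :: "('g, 'm) monoid_scheme \<Rightarrow> 'a set \<Rightarrow> ('g \<Rightarrow> 'a) set" where
  "full_shift G A = carrier G \<rightarrow>\<^sub>E A"

definition shift :: "('g, 'm) monoid_scheme \<Rightarrow> 'g \<Rightarrow> ('g \<Rightarrow> 'a) \<Rightarrow> ('g \<Rightarrow> 'a)" where
  "shift G g x = (\<lambda>h\<in>carrier G. x (inv\<^bsub>G\<^esub> g \<otimes>\<^bsub>G\<^esub> h))"

definition hoelder_continuous ::
    "('g, 'm) monoid_scheme \<Rightarrow> 'g set \<Rightarrow> 'a set \<Rightarrow> ('h \<Rightarrow> 'h \<Rightarrow> real) \<Rightarrow>
     (('g \<Rightarrow> 'a) \<Rightarrow> 'h) \<Rightarrow> bool" where
  "hoelder_continuous G S A d f \<longleftrightarrow>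
     (\<exists>C r. C > 0 \<and> 0 < r \<and> r < 1 \<and>
        (\<forall>n. \<forall>x\<in>full_shift G A. \<forall>y\<in>full_shift G A.
           (\<forall>h\<in>word_ball G S n. x h = y h) \<longrightarrow> d (f x) (f y) \<le> C * r ^ n))"

definition cocycle ::
    "('g, 'm) monoid_scheme \<Rightarrow> 'a set \<Rightarrow> ('h, 'k) monoid_scheme \<Rightarrow>
     ('g \<Rightarrow> ('g \<Rightarrow> 'a) \<Rightarrow> 'h) \<Rightarrow> bool" where
  "cocycle G A H c \<longleftrightarrow>
     (\<forall>g\<in>carrier G. \<forall>x\<in>full_shift G A. c g x \<in> carrier H) \<and>
     (\<forall>g\<in>carrier G. \<forall>h\<in>carrier G. \<forall>x\<in>full_shift G A.
        c (g \<otimes>\<^bsub>G\<^esub> h) x = c g (shift G h x) \<otimes>\<^bsub>H\<^esub> c h x)"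

definition hoelder_cocycle ::
    "('g, 'm) monoid_scheme \<Rightarrow> 'g set \<Rightarrow> 'a set \<Rightarrow> ('h, 'k) monoid_scheme \<Rightarrow>
     ('h \<Rightarrow> 'h \<Rightarrow> real) \<Rightarrow> ('g \<Rightarrow> ('g \<Rightarrow> 'a) \<Rightarrow> 'h) \<Rightarrow> bool" where
  "hoelder_cocycle G S A H d c \<longleftrightarrow>
     cocycle G A H c \<and> (\<forall>g\<in>carrier G. hoelder_continuous G S A d (c g))"

definition hoelder_cohomologous ::
    "('g, 'm) monoid_scheme \<Rightarrow> 'g set \<Rightarrow> 'a set \<Rightarrow> ('h, 'k) monoid_scheme \<Rightarrow>
     ('h \<Rightarrow> 'h \<Rightarrow> real) \<Rightarrow> ('g \<Rightarrow> ('g \<Rightarrow> 'a) \<Rightarrow> 'h) \<Rightarrow>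
     ('g \<Rightarrow> ('g \<Rightarrow> 'a) \<Rightarrow> 'h) \<Rightarrow> bool" where
  "hoelder_cohomologous G S A H d c1 c2 \<longleftrightarrow>
     (\<exists>b. (\<forall>x\<in>full_shift G A. b x \<in> carrier H) \<and> hoelder_continuous G S A d b \<and>
        (\<forall>g\<in>carrier G. \<forall>x\<in>full_shift G A.
           c1 g x = inv\<^bsub>H\<^esub> (b (shift G g x)) \<otimes>\<^bsub>H\<^esub> c2 g x \<otimes>\<^bsub>H\<^esub> b x))"

text \<open>
  Membership in the class \<open>\<G>\<^sub>H\<close>. HOL cannot quantify over types inside a formula, so the types
  in which the alphabet \<open>A\<close> and the target \<open>H\<close> live are parameters: \<open>G\<close> belongs to the class
  iff the predicate holds at all types \<open>'a\<close> and \<open>'h\<close>. The metric on \<open>H\<close> is arbitrary rather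
  than fixed once for each \<open>H\<close>.
\<close>

definition in_class_GH ::
    "'a itself \<Rightarrow> 'h itself \<Rightarrow> ('g, 'm) monoid_scheme \<Rightarrow> 'g set \<Rightarrow> bool" where
  "in_class_GH (_ :: 'a itself) (_ :: 'h itself) G S \<longleftrightarrow>
     (\<forall>(A :: 'a set) (H :: 'h monoid) T d.
        finite A \<and> polish_group H T \<and> biinvariant_metric H T d \<longrightarrow>
        (\<forall>c. hoelder_cocycle G S A H d c \<longrightarrow>
           (\<exists>\<phi>\<in>hom G H. hoelder_cohomologous G S A H d c (\<lambda>g _. \<phi> g))))"

end

theory Submission
  imports Defs
begin

text \<open>
  Write \<open>\<theta>\<^sub>h(x, y) = c(h, x)\<^sup>-\<^sup>1 c(h, y)\<close>. For \<open>x\<close>, \<open>y\<close> that agree outside a ball, \<open>h x\<close> and \<open>h y\<close>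
  agree on a ball whose radius grows like the length of \<open>h\<close>, so bi-invariance of \<open>d\<close> makes \<open>\<theta>\<^sub>h\<close>
  change by an exponentially small amount along each edge far away from \<open>1\<close>. Hence \<open>\<theta>\<close> converges
  along the powers of an undistorted element \<open>g\<close>, and subexponential divergence provides detours
  short enough to show that the limit \<open>\<Theta>(x, y)\<close> is the same along \<open>g\<^sup>n\<close>, \<open>g\<^sup>-\<^sup>n\<close> and \<open>g\<^sup>n h\<close>. The last
  of these gives \<open>\<Theta>(x, y) = c(h, x)\<^sup>-\<^sup>1 \<Theta>(h x, h y) c(h, y)\<close>.

  The point is that \<open>\<Theta>(x, y)\<close> is exponentially close to \<open>1\<close> when \<open>x\<close> and \<open>y\<close> agree on a large ball,
  uniformly in the set where they differ. As \<open>g\<close> is undistorted, a coordinate far from \<open>1\<close> is far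
  from one of the two rays \<open>g\<^sup>n\<close>, \<open>g\<^sup>-\<^sup>n\<close>. So one passes from \<open>x\<close> to \<open>y\<close> in two steps, each changing
  only coordinates far from one of the rays, and computes \<open>\<Theta>\<close> for each step along that ray.
  With a constant configuration \<open>x\<^sub>0\<close>, the map \<open>\<Theta>(x\<^sub>0, -)\<close> therefore extends to a Hoelder continuous
  transfer function, and \<open>c\<close> becomes the homomorphism \<open>h \<mapsto> c(h, x\<^sub>0)\<close>.
\<close>

section \<open>Word length\<close>

locale word_metric = group G for G :: "('g, 'm) monoid_scheme" (structure) +
  fixes S :: "'g set"
  assumes gen: "finite_symmetric_generating_set G S"
begin

abbreviation len :: "'g \<Rightarrow> nat" where
  "len \<equiv> word_length G S"

lemma S_carrier: "s \<in> S \<Longrightarrow> s \<in> carrier G"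
  and inv_S: "s \<in> S \<Longrightarrow> inv s \<in> S"
  and finite_S: "finite S"
  using gen by (auto simp: finite_symmetric_generating_set_def)

lemma foldr_carrier: "set ws \<subseteq> S \<Longrightarrow> foldr (\<otimes>) ws \<one> \<in> carrier G"
  by (induction ws) (auto simp: S_carrier)

lemma foldr_mult_append:
  "set us \<subseteq> S \<Longrightarrow> set vs \<subseteq> S \<Longrightarrow>
    foldr (\<otimes>) (us @ vs) \<one> = foldr (\<otimes>) us \<one> \<otimes> foldr (\<otimes>) vs \<one>"
proof (induction us)
  case (Cons a us)
  then show ?case
    using m_assoc[of a "foldr (\<otimes>) us \<one>" "foldr (\<otimes>) vs \<one>"]
    by (simp add: S_carrier foldr_carrier del: foldr_append)
qed (simp add: foldr_carrier)

lemma word_exists: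
  assumes "g \<in> carrier G"
  shows "\<exists>ws. set ws \<subseteq> S \<and> foldr (\<otimes>) ws \<one> = g"
proof -
  have "g \<in> generate G S"
    using assms gen by (simp add: finite_symmetric_generating_set_def)
  then show ?thesis
  proof (induction rule: generate.induct)
    case one
    show ?case by (rule exI[of _ "[]"]) simp
  next
    case (incl h)
    then show ?case by (intro exI[of _ "[h]"]) (simp add: S_carrier)
  next
    case (inv h)
    then show ?case by (intro exI[of _ "[inv h]"]) (simp add: S_carrier inv_S)
  next
    case (eng g h)
    then obtain us vs where "set us \<subseteq> S" "foldr (\<otimes>) us \<one> = g" "set vs \<subseteq> S" "foldr (\<otimes>) vs \<one> = h"
      by auto
    then show ?case
      by (intro exI[of _ "us @ vs"]) (simp add: foldr_mult_append del: foldr_append)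
  qed
qed

lemma len_le: "set ws \<subseteq> S \<Longrightarrow> len (foldr (\<otimes>) ws \<one>) \<le> length ws"
  unfolding word_length_def by (rule Least_le) blast

lemma len_word:
  assumes "g \<in> carrier G"
  obtains ws where "length ws = len g" "set ws \<subseteq> S" "foldr (\<otimes>) ws \<one> = g"
proof -
  obtain ws where "set ws \<subseteq> S" "foldr (\<otimes>) ws \<one> = g"
    using word_exists[OF assms] by blast
  then have "\<exists>n ws. length ws = n \<and> set ws \<subseteq> S \<and> foldr (\<otimes>) ws \<one> = g"
    by blast
  from LeastI_ex[OF this] show thesis
    using that unfolding word_length_def by blast
qed

lemma len_one [simp]: "len \<one> = 0"
  using len_le[of "[]"] by simp

lemma len_mult:
  assumes "g \<in> carrier G" "h \<in> carrier G"
  shows "len (g \<otimes> h) \<le> len g + len h"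
proof -
  obtain us where us: "length us = len g" "set us \<subseteq> S" "foldr (\<otimes>) us \<one> = g"
    using len_word[OF assms(1)] .
  obtain vs where vs: "length vs = len h" "set vs \<subseteq> S" "foldr (\<otimes>) vs \<one> = h"
    using len_word[OF assms(2)] .
  have "len (foldr (\<otimes>) (us @ vs) \<one>) \<le> length (us @ vs)"
    using us vs by (intro len_le) simp
  with us vs show ?thesis
    by (simp add: foldr_mult_append del: foldr_append)
qed

lemma len_inv_le:
  assumes "g \<in> carrier G"
  shows "len (inv g) \<le> len g"
proof -
  have "set ws \<subseteq> S \<Longrightarrow> len (inv (foldr (\<otimes>) ws \<one>)) \<le> length ws" for ws
  proof (induction ws)
    case (Cons s ws)
    let ?f = "foldr (\<otimes>) ws \<one>"
    have s: "s \<in> carrier G" "?f \<in> carrier G" "inv s \<in> S"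
      using Cons.prems by (auto simp: S_carrier foldr_carrier inv_S)
    have "len (inv (s \<otimes> ?f)) \<le> len (inv ?f) + len (inv s)"
      using s by (simp add: inv_mult_group len_mult)
    also have "len (inv s) \<le> 1"
      using len_le[of "[inv s]"] s by simp
    finally show ?case
      using Cons by auto
  qed simp
  then show ?thesis
    using len_word[OF assms] by metis
qed

lemma len_inv [simp]: "g \<in> carrier G \<Longrightarrow> len (inv g) = len g"
  using len_inv_le[of g] len_inv_le[of "inv g"] by simp

lemma len_diff:
  assumes "g \<in> carrier G" "h \<in> carrier G"
  shows "len g \<le> len (g \<otimes> h) + len h"
  using len_mult[of "g \<otimes> h" "inv h"] assms by (simp add: m_assoc)

lemma len_diff':
  assumes "g \<in> carrier G" "h \<in> carrier G"
  shows "len h \<le> len (g \<otimes> h) + len g"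
  using len_mult[of "inv g" "g \<otimes> h"] assms by (simp add: inv_solve_left flip: m_assoc)

section \<open>Growth along powers and detours around the identity\<close>

lemma len_pow: "g \<in> carrier G \<Longrightarrow> len (g [^] (n::nat)) \<le> n * len g"
  by (induction n) (auto intro: order_trans[OF len_mult])

lemma cayley_dist_one: "g \<in> carrier G \<Longrightarrow> cayley_dist G S \<one> g = len g"
  by (simp add: cayley_dist_def)

lemma cayley_dist_le:
  "g \<in> carrier G \<Longrightarrow> h \<in> carrier G \<Longrightarrow> cayley_dist G S g h \<le> len g + len h"
  using len_mult[of "inv g" h] by (simp add: cayley_dist_def)

text \<open>The limit controls only large exponents. Since \<open>len (g [^] (n * k))\<close> is at
  most \<open>k * len (g [^] n)\<close>, a lower bound at a large multiple of \<open>n\<close>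
  descends to \<open>n\<close> itself, so the rate \<open>L / 2\<close> holds from the
  start.\<close>

lemma undistorted_linear:
  assumes "undistorted G S g"
  obtains \<delta> where "\<delta> > 0" "\<And>n::nat. \<delta> * real n \<le> real (len (g [^] n))"
proof -
  obtain L where g: "g \<in> carrier G" and L: "L > 0"
    and lim: "(\<lambda>n::nat. real (len (g [^] n)) / real n) \<longlonglongrightarrow> L"
    using assms by (auto simp: undistorted_def)
  have "\<forall>\<^sub>F n in sequentially. L / 2 < real (len (g [^] n)) / real n"
    by (rule order_tendstoD(1)[OF lim]) (use L in simp)
  then obtain m where m: "\<And>n. n \<ge> m \<Longrightarrow> L / 2 < real (len (g [^] n)) / real n"
    by (auto simp: eventually_sequentially)
  have "L / 2 * real n \<le> real (len (g [^] n))" for n :: nat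
  proof (cases "n = 0")
    case False
    let ?k = "n * Suc m"
    have "m \<le> ?k"
      using False by (cases n) auto
    then have "L / 2 < real (len (g [^] ?k)) / real ?k"
      using m by blast
    then have "L / 2 * real ?k < real (len (g [^] ?k))"
      using False by (subst (asm) pos_less_divide_eq) (simp_all only: of_nat_0_less_iff, simp)
    also have "len (g [^] ?k) \<le> Suc m * len (g [^] n)"
      using len_pow[of "g [^] n" "Suc m"] g by (simp only: nat_pow_closed nat_pow_pow)
    finally have "L / 2 * real n * real (Suc m) < real (len (g [^] n)) * real (Suc m)"
      by (simp add: algebra_simps)
    then show ?thesis
      by (metis less_eq_real_def mult_less_cancel_right_pos of_nat_0_less_iff zero_less_Suc)
  qed simp
  with L that[of "L / 2"] show thesis by simp
qed

text \<open>Taking the identity as centre \<open>c\<close> turns the avoided ball into one for word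
  length. That \<open>u\<close> and \<open>v\<close> differ from the identity makes this centre
  admissible.\<close>

lemma divergence_path:
  assumes uv: "u \<in> carrier G" "v \<in> carrier G" "u \<noteq> \<one>" "v \<noteq> \<one>"
    and div: "divergence G S n = enat k" and n: "len u + len v \<le> n"
  defines "B \<equiv> {h \<in> carrier G. real (len h) \<le> real (min (len u) (len v)) / 2 - 2}"
  obtains m where "m \<le> k" "(u, v) \<in> cayley_minus G S B ^^ m"
proof -
  let ?N = "{m. (u, v) \<in> cayley_minus G S B ^^ m}"
  have "divergence_rel G S \<one> u v \<le> divergence_pair G S u v"
    unfolding divergence_pair_def using uv by (intro SUP_upper) auto
  also have "\<dots> \<le> divergence G S n"
    unfolding divergence_def using uv order_trans[OF cayley_dist_le n]
    by (intro SUP_upper2[of "(u, v)"]) auto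
  also have "divergence_rel G S \<one> u v = (INF m\<in>?N. enat m)"
    unfolding divergence_rel_def Let_def B_def
    using uv by (simp add: cayley_dist_one cong: conj_cong)
  finally have le: "(INF m\<in>?N. enat m) \<le> enat k"
    by (simp add: div)
  \<comment> \<open>With no path the infimum would be infinite. A nonempty set of naturals attains
    its infimum, and this yields an actual path.\<close>
  then have "?N \<noteq> {}"
    by (intro notI) (simp add: top_enat_def)
  then have "(INF m\<in>?N. enat m) \<in> enat ` ?N"
    using LeastI_ex[of "\<lambda>x. x \<in> enat ` ?N"] by (auto simp: Inf_enat_def)
  with le that show thesis
    by force
qed

end


section \<open>Geometric sequences and bi-invariant metrics\<close>

lemma (in Metric_space) dist_geometric:
  assumes u: "\<And>n. u n \<in> M"
    and step: "\<And>n. n \<ge> k \<Longrightarrow> d (u n) (u (Suc n)) \<le> K * q ^ n"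
    and q: "0 < q" "q < 1" and "K \<ge> 0" and mn: "k \<le> m" "m \<le> n"
  shows "d (u m) (u n) \<le> K * q ^ m / (1 - q)"
proof -
  \<comment> \<open>The induction carries the exact partial sum of the geometric series; the term
    \<open>q ^ n\<close> is dropped only afterwards.\<close>
  have "d (u m) (u n) \<le> K * (q ^ m - q ^ n) / (1 - q)"
    using mn(2)
  proof (induction n rule: dec_induct)
    case base
    show ?case using u by simp
  next
    case (step n)
    have "d (u m) (u (Suc n)) \<le> d (u m) (u n) + d (u n) (u (Suc n))"
      using u triangle by blast
    also have "\<dots> \<le> K * (q ^ m - q ^ n) / (1 - q) + K * q ^ n"
      using step mn assms(2)[of n] by (intro add_mono) auto
    also have "\<dots> = K * (q ^ m - q ^ Suc n) / (1 - q)"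
      using q by (simp add: field_simps)
    finally show ?case .
  qed
  also have "\<dots> \<le> K * q ^ m / (1 - q)"
    using q \<open>K \<ge> 0\<close> by (intro divide_right_mono mult_left_mono) auto
  finally show ?thesis .
qed

lemma (in Metric_space) geometric_converges:
  assumes "mcomplete" and u: "\<And>n. u n \<in> M"
    and step: "\<And>n. n \<ge> k \<Longrightarrow> d (u n) (u (Suc n)) \<le> K * q ^ n"
    and q: "0 < q" "q < 1" and K: "K \<ge> 0"
  shows "\<exists>l. limitin mtopology u l sequentially"
proof -
  have "MCauchy u"
    unfolding MCauchy_def
  proof (intro conjI allI impI)
    show "range u \<subseteq> M" using u by auto
    fix e :: real
    assume e: "e > 0"
    have "(\<lambda>n. K * q ^ n / (1 - q)) \<longlonglongrightarrow> K * 0 / (1 - q)"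
      by (intro tendsto_intros LIMSEQ_power_zero) (use q in auto)
    then have "\<forall>\<^sub>F n in sequentially. K * q ^ n / (1 - q) < e"
      using e by (intro order_tendstoD(2)) auto
    then obtain N where N: "\<And>n. n \<ge> N \<Longrightarrow> K * q ^ n / (1 - q) < e"
      by (auto simp: eventually_sequentially)
    have *: "d (u m) (u n) < e" if "max N k \<le> m" "m \<le> n" for m n
      using dist_geometric[of u k K q m n] u step q K N[of m] that by fastforce
    show "\<exists>N. \<forall>n n'. N \<le> n \<longrightarrow> N \<le> n' \<longrightarrow> d (u n) (u n') < e"
      by (rule exI[of _ "max N k"]) (metis * commute linear)
  qed
  with assms(1) show ?thesis by (simp add: mcomplete_def)
qed

lemma (in Metric_space) limitin_dist_le:
  assumes u: "limitin mtopology u l sequentially" and v: "limitin mtopology v m sequentially"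
    and uM: "\<And>n. u n \<in> M" and vM: "\<And>n. v n \<in> M"
    and le: "\<And>n. d (u n) (v n) \<le> a"
  shows "d l m \<le> a"
proof (rule LIMSEQ_le_const)
  show "(\<lambda>n. d (u n) l + a + d (v n) m) \<longlonglongrightarrow> a"
    using u v by (auto simp: limitin_metric_dist_null intro!: tendsto_eq_intros)
  have "d l m \<le> d (u n) l + a + d (v n) m" for n
    using triangle[of l "u n" m] triangle[of "u n" "v n" m] le[of n] uM vM u v commute[of l "u n"]
    by (fastforce simp: limitin_metric_dist_null)
  then show "\<exists>N. \<forall>n\<ge>N. d l m \<le> d (u n) l + a + d (v n) m"
    by blast
qed

lemma (in Metric_space) limitin_close:
  assumes u: "limitin mtopology u l sequentially" and uM: "\<And>n. u n \<in> M" and vM: "\<And>n. v n \<in> M"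
    and null: "(\<lambda>n. d (u n) (v n)) \<longlonglongrightarrow> 0"
  shows "limitin mtopology v l sequentially"
proof -
  have l: "l \<in> M" and lim: "(\<lambda>n. d (u n) l) \<longlonglongrightarrow> 0"
    using u by (auto simp: limitin_metric_dist_null)
  have "(\<lambda>n. d (v n) l) \<longlonglongrightarrow> 0"
  proof (rule tendsto_sandwich[OF always_eventually always_eventually])
    show "\<forall>n. 0 \<le> d (v n) l" by simp
    show "\<forall>n. d (v n) l \<le> d (u n) (v n) + d (u n) l"
      using triangle[of "v _" "u _" l] uM vM l by (simp add: commute[of "v _" "u _"])
    show "(\<lambda>n. d (u n) (v n) + d (u n) l) \<longlonglongrightarrow> 0"
      using tendsto_add[OF null lim] by simp
  qed simp
  with l vM show ?thesis by (simp add: limitin_metric_dist_null)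
qed

section \<open>Groups with a complete bi-invariant metric\<close>

locale biinvariant_group = group H + Metric_space "carrier H" d
  for H :: "('h, 'k) monoid_scheme" (structure) and d +
  assumes complete: "mcomplete"
    and left_invariant: "\<lbrakk>x \<in> carrier H; y \<in> carrier H; z \<in> carrier H\<rbrakk> \<Longrightarrow> d (z \<otimes> x) (z \<otimes> y) = d x y"
    and right_invariant: "\<lbrakk>x \<in> carrier H; y \<in> carrier H; z \<in> carrier H\<rbrakk> \<Longrightarrow> d (x \<otimes> z) (y \<otimes> z) = d x y"
begin

text \<open>Passing through \<open>a' \<otimes> b\<close> changes one factor at a time, and the
  invariance on each side removes the factor that stays.\<close>

lemma dist_mult:
  assumes "a \<in> carrier H" "b \<in> carrier H" "a' \<in> carrier H" "b' \<in> carrier H"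
  shows "d (a \<otimes> b) (a' \<otimes> b') \<le> d a a' + d b b'"
  using triangle[of "a \<otimes> b" "a' \<otimes> b" "a' \<otimes> b'"] assms
  by (simp add: left_invariant right_invariant)

lemma dist_inv_mult_one:
  "a \<in> carrier H \<Longrightarrow> b \<in> carrier H \<Longrightarrow> d (inv a \<otimes> b) \<one> = d a b"
  using left_invariant[of "inv a \<otimes> b" \<one> a] by (simp add: commute inv_solve_left flip: m_assoc)

lemma dist_inv:
  assumes "a \<in> carrier H" "b \<in> carrier H"
  shows "d (inv a) (inv b) = d a b"
  using right_invariant[of "inv a" "inv b" b] dist_inv_mult_one[of a b] assms by simp

lemma limitin_mult:
  assumes u: "limitin mtopology u l sequentially" and v: "limitin mtopology v m sequentially"
    and uM: "\<And>n. u n \<in> carrier H" and vM: "\<And>n. v n \<in> carrier H"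
  shows "limitin mtopology (\<lambda>n. u n \<otimes> v n) (l \<otimes> m) sequentially"
proof -
  have lm: "l \<in> carrier H" "m \<in> carrier H"
    and lim: "(\<lambda>n. d (u n) l) \<longlonglongrightarrow> 0" "(\<lambda>n. d (v n) m) \<longlonglongrightarrow> 0"
    using u v by (auto simp: limitin_metric_dist_null)
  have "(\<lambda>n. d (u n \<otimes> v n) (l \<otimes> m)) \<longlonglongrightarrow> 0"
  proof (rule tendsto_sandwich[OF always_eventually always_eventually])
    show "\<forall>n. 0 \<le> d (u n \<otimes> v n) (l \<otimes> m)" by simp
    show "\<forall>n. d (u n \<otimes> v n) (l \<otimes> m) \<le> d (u n) l + d (v n) m"
      using uM vM lm by (simp add: dist_mult)
    show "(\<lambda>n. d (u n) l + d (v n) m) \<longlonglongrightarrow> 0"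
      using tendsto_add[OF lim] by simp
  qed simp
  with lm uM vM show ?thesis by (simp add: limitin_metric_dist_null)
qed

lemma limitin_inv:
  assumes "limitin mtopology u l sequentially" "\<And>n. u n \<in> carrier H"
  shows "limitin mtopology (\<lambda>n. inv (u n)) (inv l) sequentially"
  using assms by (simp add: limitin_metric_dist_null dist_inv)

lemma limitin_const_seq: "l \<in> carrier H \<Longrightarrow> limitin mtopology (\<lambda>n. l) l sequentially"
  by (simp add: limitin_metric_dist_null)

end

section \<open>Comparing the cocycle at two configurations\<close>

text \<open>With \<open>S\<close> finite, holding for some \<open>k\<close> means that
  \<open>x\<close> and \<open>y\<close> are homoclinic: they differ at finitely many coordinates.
  The radius is explicit because the error in \<open>theta_close\<close> depends on it, while the
  bound in \<open>Theta_bound\<close> does not.\<close>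

definition agree_off :: "('g, 'm) monoid_scheme \<Rightarrow> 'g set \<Rightarrow> nat \<Rightarrow> ('g \<Rightarrow> 'a) \<Rightarrow> ('g \<Rightarrow> 'a) \<Rightarrow> bool" where
  "agree_off G S k x y \<longleftrightarrow> (\<forall>f\<in>carrier G. k < word_length G S f \<longrightarrow> x f = y f)"

text \<open>One pair \<open>C\<close>, \<open>r\<close> serves all of \<open>S\<close> together with
  \<open>g\<close> and its inverse: generators are the edges of detours, \<open>g\<close> and its
  inverse the steps along the two rays.\<close>

locale shift_cocycle =
  G: word_metric G S + H: biinvariant_group H d
  for G :: "('g, 'm) monoid_scheme" and S :: "'g set"
    and H :: "('h, 'k) monoid_scheme" and d :: "'h \<Rightarrow> 'h \<Rightarrow> real" +
  fixes A :: "'a set" and c :: "'g \<Rightarrow> ('g \<Rightarrow> 'a) \<Rightarrow> 'h" and g :: 'g and \<delta> C r :: real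
  assumes hoelder_coc: "hoelder_cocycle G S A H d c"
    and subexp: "subexponential_divergence G S"
    and g: "g \<in> carrier G" and delta: "\<delta> > 0"
    and growth: "\<And>n::nat. \<delta> * real n \<le> real (word_length G S (g [^]\<^bsub>G\<^esub> n))"
    and C: "C > 0" and r: "0 < r" "r < 1"
    and hoelder: "\<And>s n x y. \<lbrakk>s \<in> insert g (insert (inv\<^bsub>G\<^esub> g) S); x \<in> full_shift G A; y \<in> full_shift G A;
        \<And>h. h \<in> word_ball G S n \<Longrightarrow> x h = y h\<rbrakk> \<Longrightarrow> d (c s x) (c s y) \<le> C * r ^ n"
begin

abbreviation len :: "'g \<Rightarrow> nat" where "len \<equiv> word_length G S"
abbreviation X :: "('g \<Rightarrow> 'a) set" where "X \<equiv> full_shift G A"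
abbreviation act :: "'g \<Rightarrow> ('g \<Rightarrow> 'a) \<Rightarrow> 'g \<Rightarrow> 'a" where "act \<equiv> shift G"
abbreviation converges :: "(nat \<Rightarrow> 'h) \<Rightarrow> 'h \<Rightarrow> bool" where
  "converges u l \<equiv> limitin H.mtopology u l sequentially"

lemma act_closed [simp]: "x \<in> X \<Longrightarrow> h \<in> carrier G \<Longrightarrow> act h x \<in> X"
  by (auto simp: shift_def full_shift_def)

lemma act_one: "x \<in> X \<Longrightarrow> act \<one>\<^bsub>G\<^esub> x = x"
  by (rule ext) (simp add: shift_def full_shift_def restrict_def PiE_def extensional_def)

lemma c_closed [simp]: "h \<in> carrier G \<Longrightarrow> x \<in> X \<Longrightarrow> c h x \<in> carrier H"
  and c_mult: "h \<in> carrier G \<Longrightarrow> k \<in> carrier G \<Longrightarrow> x \<in> X \<Longrightarrow>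
    c (h \<otimes>\<^bsub>G\<^esub> k) x = c h (act k x) \<otimes>\<^bsub>H\<^esub> c k x"
  using hoelder_coc by (auto simp: hoelder_cocycle_def cocycle_def)

lemma c_one: "x \<in> X \<Longrightarrow> c \<one>\<^bsub>G\<^esub> x = \<one>\<^bsub>H\<^esub>"
  using c_mult[of "\<one>\<^bsub>G\<^esub>" "\<one>\<^bsub>G\<^esub>" x] c_closed[of "\<one>\<^bsub>G\<^esub>" x] act_one[of x]
  by (metis G.one_closed G.r_one H.l_cancel_one)

definition \<theta> :: "('g \<Rightarrow> 'a) \<Rightarrow> ('g \<Rightarrow> 'a) \<Rightarrow> 'g \<Rightarrow> 'h" where
  "\<theta> x y h = inv\<^bsub>H\<^esub> (c h x) \<otimes>\<^bsub>H\<^esub> c h y"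

lemma theta_closed [simp]: "x \<in> X \<Longrightarrow> y \<in> X \<Longrightarrow> h \<in> carrier G \<Longrightarrow> \<theta> x y h \<in> carrier H"
  by (simp add: \<theta>_def)

lemma theta_one: "x \<in> X \<Longrightarrow> y \<in> X \<Longrightarrow> \<theta> x y \<one>\<^bsub>G\<^esub> = \<one>\<^bsub>H\<^esub>"
  by (simp add: \<theta>_def c_one)

lemma theta_trans:
  assumes "x \<in> X" "y \<in> X" "z \<in> X" "h \<in> carrier G"
  shows "\<theta> x y h \<otimes>\<^bsub>H\<^esub> \<theta> y z h = \<theta> x z h"
proof -
  have "c h y \<otimes>\<^bsub>H\<^esub> (inv\<^bsub>H\<^esub> (c h y) \<otimes>\<^bsub>H\<^esub> c h z) = c h z"
    using assms by (simp flip: H.m_assoc)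
  then show ?thesis
    using assms by (simp add: \<theta>_def H.m_assoc)
qed

lemma theta_mult:
  assumes "x \<in> X" "y \<in> X" "h \<in> carrier G" "k \<in> carrier G"
  shows "\<theta> x y (h \<otimes>\<^bsub>G\<^esub> k) =
    inv\<^bsub>H\<^esub> (c k x) \<otimes>\<^bsub>H\<^esub> \<theta> (act k x) (act k y) h \<otimes>\<^bsub>H\<^esub> c k y"
  using assms by (simp add: \<theta>_def c_mult H.inv_mult_group H.m_assoc)

text \<open>Both values share the outer factors \<open>inv (c h x)\<close> and \<open>c h y\<close>.
  Bi-invariance strips them, however far from the identity they are, and leaves only the cocycle at
  \<open>s\<close>.\<close>

lemma theta_step:
  assumes "x \<in> X" "y \<in> X" "s \<in> carrier G" "h \<in> carrier G"
  shows "d (\<theta> x y h) (\<theta> x y (s \<otimes>\<^bsub>G\<^esub> h)) = d (c s (act h x)) (c s (act h y))"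
proof -
  let ?p = "inv\<^bsub>H\<^esub> (c h x)" and ?e = "\<theta> (act h x) (act h y) s" and ?q = "c h y"
  have "d (\<theta> x y h) (\<theta> x y (s \<otimes>\<^bsub>G\<^esub> h)) = d (?p \<otimes>\<^bsub>H\<^esub> \<one>\<^bsub>H\<^esub> \<otimes>\<^bsub>H\<^esub> ?q) (?p \<otimes>\<^bsub>H\<^esub> ?e \<otimes>\<^bsub>H\<^esub> ?q)"
    using assms by (simp add: theta_mult) (simp add: \<theta>_def)
  also have "\<dots> = d \<one>\<^bsub>H\<^esub> ?e"
    using assms by (simp only: H.right_invariant H.left_invariant H.m_closed H.inv_closed c_closed
      theta_closed act_closed H.one_closed)
  also have "\<dots> = d (c s (act h x)) (c s (act h y))"
    using assms H.dist_inv_mult_one[of "c s (act h x)" "c s (act h y)"]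
    by (simp add: \<theta>_def H.commute)
  finally show ?thesis .
qed

text \<open>The configurations \<open>act h x\<close> and \<open>act h y\<close> disagree exactly at
  the points \<open>h f\<close> with \<open>x f \<noteq> y f\<close>, so they agree on every ball of
  radius below \<open>t\<close>, where the Hoelder bound applies.\<close>

lemma step_bound:
  assumes x: "x \<in> X" "y \<in> X" and s: "s \<in> insert g (insert (inv\<^bsub>G\<^esub> g) S)" and h: "h \<in> carrier G"
    and t: "0 < t" and far: "\<And>f. f \<in> carrier G \<Longrightarrow> x f \<noteq> y f \<Longrightarrow> t \<le> real (len (h \<otimes>\<^bsub>G\<^esub> f))"
  shows "d (\<theta> x y h) (\<theta> x y (s \<otimes>\<^bsub>G\<^esub> h)) \<le> C / r * r powr t"
proof -
  \<comment> \<open>The largest integer strictly below \<open>t\<close>, since a disagreement may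
    sit at length exactly \<open>t\<close>. Rounding loses at most 1, which costs the factor
    \<open>1 / r\<close>.\<close>
  define n where "n = nat (\<lceil>t\<rceil> - 1)"
  have n: "real n < t" "t - 1 \<le> real n"
    using t unfolding n_def by linarith+
  have "d (c s (act h x)) (c s (act h y)) \<le> C * r ^ n"
  proof (rule hoelder[OF s])
    fix k
    assume k: "k \<in> word_ball G S n"
    then have k': "k \<in> carrier G" "len k \<le> n"
      by (auto simp: word_ball_def)
    have "h \<otimes>\<^bsub>G\<^esub> (inv\<^bsub>G\<^esub> h \<otimes>\<^bsub>G\<^esub> k) = k"
      using h k' by (simp flip: G.m_assoc)
    then have "x (inv\<^bsub>G\<^esub> h \<otimes>\<^bsub>G\<^esub> k) = y (inv\<^bsub>G\<^esub> h \<otimes>\<^bsub>G\<^esub> k)"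
      using far[of "inv\<^bsub>G\<^esub> h \<otimes>\<^bsub>G\<^esub> k"] h k' n(1) by fastforce
    then show "act h x k = act h y k"
      by (simp add: shift_def)
  qed (use x h in auto)
  also have "r ^ n = r powr real n"
    using r by (simp add: powr_realpow)
  also have "C * r powr real n \<le> C * r powr (t - 1)"
    using C r n by (intro mult_left_mono powr_mono') auto
  also have "\<dots> = C / r * r powr t"
    using r by (simp add: powr_diff)
  finally show ?thesis
    using x s h g by (auto simp: theta_step G.S_carrier)
qed

text \<open>Edges of the Cayley graph multiply on the right, \<open>step_bound\<close> on the left;
  evaluating \<theta> at inverses of the vertices reconciles them. The cost is then linear in the
  length of the path.\<close>

lemma path_bound:
  assumes x: "x \<in> X" "y \<in> X" and uv: "(u, v) \<in> cayley_minus G S B ^^ m" and u: "u \<in> carrier G"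
    and t: "0 < t"
    and far: "\<And>w f. w \<in> carrier G - B \<Longrightarrow> f \<in> carrier G \<Longrightarrow> x f \<noteq> y f \<Longrightarrow>
      t \<le> real (len (inv\<^bsub>G\<^esub> w \<otimes>\<^bsub>G\<^esub> f))"
  shows "v \<in> carrier G \<and> d (\<theta> x y (inv\<^bsub>G\<^esub> u)) (\<theta> x y (inv\<^bsub>G\<^esub> v)) \<le> real m * (C / r * r powr t)"
  using uv
proof (induction m arbitrary: v)
  case 0
  with u x show ?case by simp
next
  case (Suc m)
  then obtain w where w: "(u, w) \<in> cayley_minus G S B ^^ m" "(w, v) \<in> cayley_minus G S B"
    by auto
  from w(2) obtain s where s: "w \<in> carrier G - B" "s \<in> S" "v = w \<otimes>\<^bsub>G\<^esub> s"
    by (auto simp: cayley_minus_def cayley_graph_def)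
  have v: "v \<in> carrier G" and vw: "inv\<^bsub>G\<^esub> v = inv\<^bsub>G\<^esub> s \<otimes>\<^bsub>G\<^esub> inv\<^bsub>G\<^esub> w"
    using s by (auto simp: G.S_carrier G.inv_mult_group)
  have "d (\<theta> x y (inv\<^bsub>G\<^esub> w)) (\<theta> x y (inv\<^bsub>G\<^esub> v)) \<le> C / r * r powr t"
    unfolding vw using x s far[of w] t by (intro step_bound) (auto simp: G.inv_S)
  moreover have "d (\<theta> x y (inv\<^bsub>G\<^esub> u)) (\<theta> x y (inv\<^bsub>G\<^esub> v)) \<le>
      d (\<theta> x y (inv\<^bsub>G\<^esub> u)) (\<theta> x y (inv\<^bsub>G\<^esub> w)) + d (\<theta> x y (inv\<^bsub>G\<^esub> w)) (\<theta> x y (inv\<^bsub>G\<^esub> v))"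
    using x s u v by (intro H.triangle) auto
  ultimately show ?case
    using v Suc.IH[OF w(1)] unfolding of_nat_Suc distrib_right mult_1 by linarith
qed

lemma divergence_bound:
  assumes q: "0 < q" "q < 1"
  obtains M :: "nat \<Rightarrow> nat" where "\<forall>\<^sub>F n in sequentially. divergence G S n = enat (M n)"
    "(\<lambda>n. real (M n) * q ^ n) \<longlonglongrightarrow> 0"
proof -
  let ?M = "\<lambda>n. the_enat (divergence G S n)"
  have lim: "(\<lambda>n. ereal_of_enat (divergence G S n) * ereal (q ^ n)) \<longlonglongrightarrow> 0"
    using subexp q by (simp add: subexponential_divergence_def)
  \<comment> \<open>A product of \<infinity> with a positive number is \<infinity>, so staying below
    1 forces the divergence to be finite from some point on.\<close>
  have "\<forall>\<^sub>F n in sequentially. ereal_of_enat (divergence G S n) * ereal (q ^ n) < 1"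
    by (rule order_tendstoD(2)[OF lim]) simp
  then have fin: "\<forall>\<^sub>F n in sequentially. divergence G S n = enat (?M n)"
  proof eventually_elim
    case (elim n)
    then show ?case
      using q by (cases "divergence G S n") auto
  qed
  have "\<forall>\<^sub>F n in sequentially.
      ereal_of_enat (divergence G S n) * ereal (q ^ n) = ereal (real (?M n) * q ^ n)"
    using fin
  proof eventually_elim
    case (elim n)
    have "ereal_of_enat (enat (?M n)) * ereal (q ^ n) = ereal (real (?M n) * q ^ n)"
      by simp
    with elim show ?case by simp
  qed
  from Lim_transform_eventually[OF lim this]
  have "(\<lambda>n. ereal (real (?M n) * q ^ n)) \<longlonglongrightarrow> ereal 0"
    by (simp add: zero_ereal_def)
  then have "(\<lambda>n. real (?M n) * q ^ n) \<longlonglongrightarrow> 0"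
    by simp
  then show thesis by (rule that[OF fin])
qed

section \<open>The limit along an undistorted element\<close>

text \<open>A detour from \<open>u n\<close> to \<open>v n\<close> avoids a ball of radius about
  \<open>\<eta> * n / 2\<close>, so each edge costs about \<open>r powr (\<eta> * n / 2)\<close>,
  while the number of edges is at most the divergence at \<open>K * n\<close>. Exponential decay
  beats subexponential growth.\<close>

lemma theta_close:
  assumes x: "x \<in> X" "y \<in> X" "agree_off G S k x y"
    and uv: "\<And>n. u n \<in> carrier G" "\<And>n. v n \<in> carrier G"
    and \<eta>: "\<eta> > 0" and K: "K > 0"
    and u: "\<forall>\<^sub>F n in sequentially. \<eta> * real n \<le> real (len (u n))"
    and v: "\<forall>\<^sub>F n in sequentially. \<eta> * real n \<le> real (len (v n))"
    and le: "\<forall>\<^sub>F n in sequentially. len (u n) + len (v n) \<le> K * n"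
  shows "(\<lambda>n. d (\<theta> x y (inv\<^bsub>G\<^esub> (u n))) (\<theta> x y (inv\<^bsub>G\<^esub> (v n)))) \<longlonglongrightarrow> 0"
proof -
  \<comment> \<open>Chosen so that \<open>q ^ (K * n) = r powr (\<eta> * n / 2)\<close>: the decay
    per edge, expressed at the scale at which the divergence is evaluated.\<close>
  define q where "q = r powr (\<eta> / (2 * real K))"
  have q: "0 < q" "q < 1"
    using r \<eta> K by (auto simp: q_def powr01_less_one)
  obtain M where M: "\<forall>\<^sub>F n in sequentially. divergence G S n = enat (M n)"
    "(\<lambda>n. real (M n) * q ^ n) \<longlonglongrightarrow> 0"
    using divergence_bound[OF q] .
  have mono: "filterlim (\<lambda>n. K * n) sequentially sequentially"
    using K by (intro filterlim_subseq) (auto simp: strict_mono_def)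
  \<comment> \<open>Absorbs the two fixed losses in the exponent: 2 from the radius of the avoided
    ball, \<open>k\<close> from the coordinates of disagreement.\<close>
  define D where "D = C / r * r powr (- 2 - real k)"
  have lim: "(\<lambda>n. D * (real (M (K * n)) * q ^ (K * n))) \<longlonglongrightarrow> 0"
    using tendsto_mult_right_zero[OF filterlim_compose[OF M(2) mono]] by simp
  have M': "\<forall>\<^sub>F n in sequentially. divergence G S (K * n) = enat (M (K * n))"
    by (rule eventually_compose_filterlim[OF M(1) mono])
  \<comment> \<open>Exactly the condition \<open>t > 0\<close> below, which also rules out that
    \<open>u n\<close> or \<open>v n\<close> is the identity.\<close>
  have large: "\<forall>\<^sub>F n in sequentially. (2 + real k) * 2 / \<eta> < real n"
    by (rule eventually_compose_filterlim[OF eventually_gt_at_top filterlim_real_sequentially])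
  have "\<forall>\<^sub>F n in sequentially. d (\<theta> x y (inv\<^bsub>G\<^esub> (u n))) (\<theta> x y (inv\<^bsub>G\<^esub> (v n)))
      \<le> D * (real (M (K * n)) * q ^ (K * n))"
    using u v le M' large
  proof eventually_elim
    case (elim n)
    define t where "t = \<eta> * real n / 2 - 2 - real k"
    have t: "t > 0"
      using elim(5) \<eta> by (simp add: t_def field_simps)
    have "0 < \<eta> * real n"
      using t by (simp add: t_def)
    then have ne: "u n \<noteq> \<one>\<^bsub>G\<^esub>" "v n \<noteq> \<one>\<^bsub>G\<^esub>"
      using elim(1,2) by auto
    define B where
      "B = {h \<in> carrier G. real (len h) \<le> real (min (len (u n)) (len (v n))) / 2 - 2}"
    obtain m where m: "m \<le> M (K * n)" "(u n, v n) \<in> cayley_minus G S B ^^ m"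
      unfolding B_def using G.divergence_path[OF uv ne elim(4,3)] by blast
    have "d (\<theta> x y (inv\<^bsub>G\<^esub> (u n))) (\<theta> x y (inv\<^bsub>G\<^esub> (v n))) \<le> real m * (C / r * r powr t)"
    proof (rule path_bound[OF x(1,2) m(2) uv(1) t, THEN conjunct2])
      fix w f
      assume w: "w \<in> carrier G - B" and f: "f \<in> carrier G" "x f \<noteq> y f"
      have "real (len w) > \<eta> * real n / 2 - 2"
        using w elim(1,2) by (auto simp: B_def min_def split: if_splits)
      moreover have "len f \<le> k"
        using x(3) f by (meson agree_off_def not_le)
      moreover have "len w \<le> len (inv\<^bsub>G\<^esub> w \<otimes>\<^bsub>G\<^esub> f) + len f"
        using G.len_diff[of "inv\<^bsub>G\<^esub> w" f] w f by simp
      ultimately show "t \<le> real (len (inv\<^bsub>G\<^esub> w \<otimes>\<^bsub>G\<^esub> f))"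
        by (simp add: t_def)
    qed
    also have "\<dots> \<le> real (M (K * n)) * (C / r * r powr t)"
      using m(1) C r by (intro mult_right_mono) auto
    also have "r powr t = r powr (- 2 - real k) * q ^ (K * n)"
      using r K by (simp add: q_def powr_power t_def flip: powr_add) (simp add: algebra_simps)
    finally show ?case
      by (simp add: D_def algebra_simps)
  qed
  then show ?thesis
    by (intro tendsto_sandwich[OF _ _ tendsto_const lim]) auto
qed

abbreviation pow :: "'g \<Rightarrow> nat \<Rightarrow> 'g" where "pow h n \<equiv> h [^]\<^bsub>G\<^esub> n"

text \<open>The power \<open>g ^ n\<close> carries the ball of radius \<open>k\<close> to lengths at
  least \<open>\<delta> * n - k\<close>, so consecutive values differ by a geometrically small
  amount.\<close>

lemma theta_converges:
  assumes x: "x \<in> X" "y \<in> X" "agree_off G S k x y"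
  shows "\<exists>l. converges (\<lambda>n. \<theta> x y (pow g n)) l"
proof -
  \<comment> \<open>Past \<open>n0\<close> the quantity \<open>\<delta> * n - k\<close> is positive,
    as \<open>step_bound\<close> requires.\<close>
  obtain n0 where n0: "real k / \<delta> < real n0"
    using reals_Archimedean2 by blast
  show ?thesis
  proof (rule H.geometric_converges[OF H.complete, where k = n0])
    show "\<theta> x y (pow g n) \<in> carrier H" for n
      using x g by simp
    show "0 < r powr \<delta>" "r powr \<delta> < 1" "0 \<le> C / r * r powr (- real k)"
      using r delta C by (auto simp: powr01_less_one)
    fix n
    assume n: "n0 \<le> n"
    have "real k < \<delta> * real n0"
      using n0 delta by (simp add: field_simps)
    also have "\<dots> \<le> \<delta> * real n"
      using n delta by (intro mult_left_mono) auto
    finally have t: "0 < \<delta> * real n - real k" by simp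
    have "d (\<theta> x y (pow g n)) (\<theta> x y (g \<otimes>\<^bsub>G\<^esub> pow g n)) \<le> C / r * r powr (\<delta> * real n - real k)"
    proof (rule step_bound[OF x(1,2) _ _ t])
      fix f
      assume f: "f \<in> carrier G" "x f \<noteq> y f"
      have "len f \<le> k"
        using x(3) f by (meson agree_off_def not_le)
      then show "\<delta> * real n - real k \<le> real (len (pow g n \<otimes>\<^bsub>G\<^esub> f))"
        using growth[of n] G.len_diff[of "pow g n" f] g f by simp
    qed (use g in auto)
    also have "r powr (\<delta> * real n - real k) = r powr (- real k) * (r powr \<delta>) ^ n"
      using r by (simp add: powr_power mult.commute flip: powr_add)
    finally show "d (\<theta> x y (pow g n)) (\<theta> x y (pow g (Suc n))) \<le>
        C / r * r powr (- real k) * (r powr \<delta>) ^ n"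
      using g by (simp only: G.nat_pow_Suc2 mult.assoc)
  qed
qed

text \<open>The choice is meaningful only where the limit exists, in particular for pairs that agree
  off some ball.\<close>

definition \<Theta> :: "('g \<Rightarrow> 'a) \<Rightarrow> ('g \<Rightarrow> 'a) \<Rightarrow> 'h" where
  "\<Theta> x y = (SOME l. converges (\<lambda>n. \<theta> x y (pow g n)) l)"

lemma Theta_limit:
  "x \<in> X \<Longrightarrow> y \<in> X \<Longrightarrow> agree_off G S k x y \<Longrightarrow> converges (\<lambda>n. \<theta> x y (pow g n)) (\<Theta> x y)"
  unfolding \<Theta>_def by (rule someI_ex) (rule theta_converges)

lemma Theta_closed:
  "x \<in> X \<Longrightarrow> y \<in> X \<Longrightarrow> agree_off G S k x y \<Longrightarrow> \<Theta> x y \<in> carrier H"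
  using Theta_limit[of x y k] by (simp add: H.limitin_metric_dist_null)

lemma len_pow_linear: "len (pow g n) \<le> len g * n"
  using G.len_pow[OF g, of n] by (simp add: mult.commute)

lemma Theta_limit_translate:
  assumes x: "x \<in> X" "y \<in> X" "agree_off G S k x y" and h: "h \<in> carrier G"
  shows "converges (\<lambda>n. \<theta> x y (pow g n \<otimes>\<^bsub>G\<^esub> h)) (\<Theta> x y)"
proof -
  let ?u = "\<lambda>n. inv\<^bsub>G\<^esub> (pow g n)" and ?v = "\<lambda>n. inv\<^bsub>G\<^esub> (pow g n \<otimes>\<^bsub>G\<^esub> h)"
  \<comment> \<open>The two lengths add up to at most \<open>2 * n * len g + len h\<close>, which is
    below \<open>?K * n\<close> once \<open>n \<ge> 1\<close>; the summand 1 keeps \<open>?K\<close>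
    positive.\<close>
  let ?K = "2 * len g + len h + 1"
  have len_v: "len (?v n) = len (pow g n \<otimes>\<^bsub>G\<^esub> h)" for n
    using g h by (intro G.len_inv) auto
  \<comment> \<open>Translation by \<open>h\<close> costs up to \<open>len h\<close>; halving the
    rate \<delta> absorbs this for large \<open>n\<close>.\<close>
  have large: "\<forall>\<^sub>F n in sequentially. 2 * real (len h) / \<delta> < real n"
    by (rule eventually_compose_filterlim[OF eventually_gt_at_top filterlim_real_sequentially])
  have "(\<lambda>n. d (\<theta> x y (inv\<^bsub>G\<^esub> (?u n))) (\<theta> x y (inv\<^bsub>G\<^esub> (?v n)))) \<longlonglongrightarrow> 0"
  proof (rule theta_close[OF x, where \<eta> = "\<delta> / 2" and K = ?K])
    show "\<forall>\<^sub>F n in sequentially. \<delta> / 2 * real n \<le> real (len (?u n))"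
    proof (intro always_eventually allI)
      show "\<delta> / 2 * real n \<le> real (len (?u n))" for n
        using growth[of n] delta g mult_nonneg_nonneg[of \<delta> "real n"] by simp
    qed
    show "\<forall>\<^sub>F n in sequentially. \<delta> / 2 * real n \<le> real (len (?v n))"
      using large
    proof eventually_elim
      case (elim n)
      then have "2 * real (len h) < \<delta> * real n"
        using delta by (simp add: field_simps)
      then show ?case
        using growth[of n] G.len_diff[of "pow g n" h] g h unfolding len_v by simp
    qed
    show "\<forall>\<^sub>F n in sequentially. len (?u n) + len (?v n) \<le> ?K * n"
      using eventually_ge_at_top[of 1]
    proof eventually_elim
      case (elim n)
      have "len h * 1 \<le> len h * n"
        using elim by (intro mult_left_mono) auto
      moreover have "len (?u n) = len (pow g n)" "len (pow g n \<otimes>\<^bsub>G\<^esub> h) \<le> len (pow g n) + len h"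
        using g h by (auto intro: G.len_mult)
      ultimately show ?case
        using len_pow_linear[of n] unfolding len_v distrib_right mult.assoc by linarith
    qed
  qed (use g h delta in auto)
  then have "(\<lambda>n. d (\<theta> x y (pow g n)) (\<theta> x y (pow g n \<otimes>\<^bsub>G\<^esub> h))) \<longlonglongrightarrow> 0"
    using g h by simp
  from H.limitin_close[OF Theta_limit[OF x] _ _ this] show ?thesis
    using x g h by simp
qed

text \<open>The two vertices lie on opposite rays. The path along the powers of \<open>g\<close>
  would run through the identity, where steps are not small, so the comparison needs the detour
  supplied by \<open>theta_close\<close>.\<close>

lemma Theta_limit_inverse:
  assumes x: "x \<in> X" "y \<in> X" "agree_off G S k x y"
  shows "converges (\<lambda>n. \<theta> x y (pow (inv\<^bsub>G\<^esub> g) n)) (\<Theta> x y)"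
proof -
  have "(\<lambda>n. d (\<theta> x y (inv\<^bsub>G\<^esub> (inv\<^bsub>G\<^esub> (pow g n)))) (\<theta> x y (inv\<^bsub>G\<^esub> (pow g n)))) \<longlonglongrightarrow> 0"
  proof (rule theta_close[OF x, where \<eta> = \<delta> and K = "2 * len g + 1"])
    show "\<forall>\<^sub>F n in sequentially. len (inv\<^bsub>G\<^esub> (pow g n)) + len (pow g n) \<le> (2 * len g + 1) * n"
    proof (intro always_eventually allI)
      show "len (inv\<^bsub>G\<^esub> (pow g n)) + len (pow g n) \<le> (2 * len g + 1) * n" for n
        using len_pow_linear[of n] G.len_inv[of "pow g n"] g
        unfolding distrib_right mult.assoc by simp
    qed
  qed (use g growth delta in auto)
  then have "(\<lambda>n. d (\<theta> x y (pow g n)) (\<theta> x y (pow (inv\<^bsub>G\<^esub> g) n))) \<longlonglongrightarrow> 0"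
    using g by (simp add: G.nat_pow_inv)
  from H.limitin_close[OF Theta_limit[OF x] _ _ this] show ?thesis
    using x g by simp
qed

lemma agree_off_act:
  assumes x: "x \<in> X" "y \<in> X" "agree_off G S k x y" and h: "h \<in> carrier G"
  shows "agree_off G S (k + len h) (act h x) (act h y)"
  unfolding agree_off_def
proof (intro ballI impI)
  fix f
  assume f: "f \<in> carrier G" "k + len h < len f"
  have "len f \<le> len (inv\<^bsub>G\<^esub> h \<otimes>\<^bsub>G\<^esub> f) + len h"
    using G.len_diff'[of "inv\<^bsub>G\<^esub> h" f] f h by simp
  then have "x (inv\<^bsub>G\<^esub> h \<otimes>\<^bsub>G\<^esub> f) = y (inv\<^bsub>G\<^esub> h \<otimes>\<^bsub>G\<^esub> f)"
    using f h x(3) unfolding agree_off_def by simp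
  then show "act h x f = act h y f"
    by (simp add: shift_def)
qed

text \<open>Two evaluations of one limit along \<open>g ^ n\<close> times \<open>h\<close>: directly
  by \<open>Theta_limit_translate\<close>, and after splitting off \<open>h\<close> by
  \<open>theta_mult\<close>.\<close>

lemma Theta_act:
  assumes x: "x \<in> X" "y \<in> X" "agree_off G S k x y" and h: "h \<in> carrier G"
  shows "\<Theta> x y = inv\<^bsub>H\<^esub> (c h x) \<otimes>\<^bsub>H\<^esub> \<Theta> (act h x) (act h y) \<otimes>\<^bsub>H\<^esub> c h y"
proof -
  have "converges (\<lambda>n. inv\<^bsub>H\<^esub> (c h x) \<otimes>\<^bsub>H\<^esub> \<theta> (act h x) (act h y) (pow g n) \<otimes>\<^bsub>H\<^esub> c h y)
      (inv\<^bsub>H\<^esub> (c h x) \<otimes>\<^bsub>H\<^esub> \<Theta> (act h x) (act h y) \<otimes>\<^bsub>H\<^esub> c h y)"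
    using Theta_limit[OF _ _ agree_off_act[OF assms]] x h g
    by (intro H.limitin_mult H.limitin_const_seq) auto
  then have "converges (\<lambda>n. \<theta> x y (pow g n \<otimes>\<^bsub>G\<^esub> h))
      (inv\<^bsub>H\<^esub> (c h x) \<otimes>\<^bsub>H\<^esub> \<Theta> (act h x) (act h y) \<otimes>\<^bsub>H\<^esub> c h y)"
    using x h g by (simp add: theta_mult)
  then show ?thesis
    using H.limitin_metric_unique Theta_limit_translate[OF assms] trivial_limit_sequentially by blast
qed

lemma Theta_trans:
  assumes x: "x \<in> X" "y \<in> X" "z \<in> X"
    and off: "agree_off G S k x y" "agree_off G S k y z" "agree_off G S k x z"
  shows "\<Theta> x y \<otimes>\<^bsub>H\<^esub> \<Theta> y z = \<Theta> x z"
proof -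
  have "converges (\<lambda>n. \<theta> x y (pow g n) \<otimes>\<^bsub>H\<^esub> \<theta> y z (pow g n)) (\<Theta> x y \<otimes>\<^bsub>H\<^esub> \<Theta> y z)"
    using x g off by (intro H.limitin_mult Theta_limit) auto
  then have "converges (\<lambda>n. \<theta> x z (pow g n)) (\<Theta> x y \<otimes>\<^bsub>H\<^esub> \<Theta> y z)"
    using x g by (simp add: theta_trans)
  then show ?thesis
    using H.limitin_metric_unique Theta_limit[OF x(1,3) off(3)] trivial_limit_sequentially by blast
qed

section \<open>The transfer function\<close>

text \<open>At exponent 0 the value is the identity, so the distance to the limit is bounded by the
  whole geometric series. Because \<open>far\<close> holds from the first step on, the size of the
  set of disagreement does not enter.\<close>

lemma ray_bound:
  assumes x: "x \<in> X" "y \<in> X" and p: "p \<in> {g, inv\<^bsub>G\<^esub> g}"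
    and lim: "converges (\<lambda>n. \<theta> x y (pow p n)) l"
    and \<epsilon>: "\<epsilon> > 0" and N: "N > 0"
    and far: "\<And>f i. f \<in> carrier G \<Longrightarrow> x f \<noteq> y f \<Longrightarrow> \<epsilon> * (N + real i) \<le> real (len (pow p i \<otimes>\<^bsub>G\<^esub> f))"
  shows "d l \<one>\<^bsub>H\<^esub> \<le> C / r * r powr (\<epsilon> * N) / (1 - r powr \<epsilon>)"
proof -
  have p': "p \<in> carrier G"
    using p g by auto
  define u where "u n = \<theta> x y (pow p n)" for n :: nat
  have q: "0 < r powr \<epsilon>" "r powr \<epsilon> < 1"
    using r \<epsilon> by (auto simp: powr01_less_one)
  have u: "u n \<in> carrier H" for n
    using x p' by (simp add: u_def)
  have step: "d (u n) (u (Suc n)) \<le> C / r * r powr (\<epsilon> * N) * (r powr \<epsilon>) ^ n" for n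
  proof -
    have "d (\<theta> x y (pow p n)) (\<theta> x y (p \<otimes>\<^bsub>G\<^esub> pow p n)) \<le> C / r * r powr (\<epsilon> * (N + real n))"
      using x p p' \<epsilon> N far by (intro step_bound) auto
    also have "r powr (\<epsilon> * (N + real n)) = r powr (\<epsilon> * N) * (r powr \<epsilon>) ^ n"
      using r by (simp add: powr_power distrib_left mult.commute flip: powr_add)
    finally show ?thesis
      using p' by (simp only: u_def G.nat_pow_Suc2 mult.assoc)
  qed
  have "d (u n) (u 0) \<le> C / r * r powr (\<epsilon> * N) / (1 - r powr \<epsilon>)" for n
  proof -
    have "d (u 0) (u n) \<le> C / r * r powr (\<epsilon> * N) * (r powr \<epsilon>) ^ 0 / (1 - r powr \<epsilon>)"
      using C r by (intro H.dist_geometric[OF u step q]) auto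
    then show ?thesis by (simp add: H.commute)
  qed
  moreover have "u 0 = \<one>\<^bsub>H\<^esub>"
    using x by (simp add: u_def theta_one)
  moreover have "converges u l"
    using lim by (simp add: u_def[abs_def])
  ultimately show ?thesis
    using u by (intro H.limitin_dist_le[of u l "\<lambda>_. \<one>\<^bsub>H\<^esub>"] H.limitin_const_seq) auto
qed

text \<open>
  Small enough that no point at distance at least \<open>N\<close> from \<open>1\<close> is within \<open>\<epsilon> (N + i)\<close> of \<open>g\<^sup>i\<close> and within
  \<open>\<epsilon> (N + j)\<close> of \<open>g\<^sup>-\<^sup>j\<close>, whatever \<open>i, j \<ge> 0\<close>.
\<close>

definition \<epsilon> :: real where "\<epsilon> = \<delta> / (8 * real (len g))"

lemma delta_le: "\<delta> \<le> real (len g)"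
  using growth[of 1] g by simp

lemma eps: "\<epsilon> > 0" "\<epsilon> * real (len g) = \<delta> / 8" "\<epsilon> \<le> 1 / 8" "8 * \<epsilon> \<le> \<delta>"
proof -
  have "real (len g) > 0" "len g \<ge> 1"
    using delta delta_le by linarith+
  then show "\<epsilon> > 0" "\<epsilon> * real (len g) = \<delta> / 8" "\<epsilon> \<le> 1 / 8" "8 * \<epsilon> \<le> \<delta>"
    using delta delta_le by (auto simp: \<epsilon>_def field_simps)
qed

text \<open>If both fail, \<open>f\<close> is close to a point of each ray. Linear growth of
  \<open>g ^ (i + j)\<close> then makes \<open>i + j\<close> small compared with \<open>N\<close>,
  while reaching a point of length at least \<open>N\<close> makes \<open>i\<close> large.\<close>

lemma far_from_a_ray:
  assumes f: "f \<in> carrier G" and N: "N \<le> real (len f)" "N > 0"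
  shows "(\<forall>i. \<epsilon> * (N + real i) \<le> real (len (pow g i \<otimes>\<^bsub>G\<^esub> f))) \<or>
    (\<forall>j. \<epsilon> * (N + real j) \<le> real (len (pow (inv\<^bsub>G\<^esub> g) j \<otimes>\<^bsub>G\<^esub> f)))"
proof (rule ccontr)
  assume "\<not> ?thesis"
  then obtain i j where i: "real (len (pow g i \<otimes>\<^bsub>G\<^esub> f)) < \<epsilon> * (N + real i)"
    and j: "real (len (pow (inv\<^bsub>G\<^esub> g) j \<otimes>\<^bsub>G\<^esub> f)) < \<epsilon> * (N + real j)"
    by (auto simp: not_le)
  let ?a = "pow g i \<otimes>\<^bsub>G\<^esub> f" and ?b = "pow (inv\<^bsub>G\<^esub> g) j \<otimes>\<^bsub>G\<^esub> f"
  \<comment> \<open>In the product of \<open>?a\<close> with the inverse of \<open>?b\<close> the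
    element \<open>f\<close> cancels, leaving a power of \<open>g\<close>.\<close>
  have "f \<otimes>\<^bsub>G\<^esub> (inv\<^bsub>G\<^esub> f \<otimes>\<^bsub>G\<^esub> pow g j) = pow g j"
    using f g by (simp flip: G.m_assoc)
  then have "?a \<otimes>\<^bsub>G\<^esub> inv\<^bsub>G\<^esub> ?b = pow g i \<otimes>\<^bsub>G\<^esub> pow g j"
    using f g by (simp add: G.inv_mult_group G.nat_pow_inv G.m_assoc)
  also have "\<dots> = pow g (i + j)"
    using f g by (simp add: G.nat_pow_mult)
  finally have "len (pow g (i + j)) \<le> len ?a + len ?b"
    using G.len_mult[of ?a "inv\<^bsub>G\<^esub> ?b"] f g by simp
  with growth[of "i + j"] i j
  have 1: "\<delta> * real i + \<delta> * real j < \<epsilon> * (2 * N + real i + real j)"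
    by (simp add: distrib_left)
  have "len f \<le> len ?a + len (pow g i)"
    using G.len_diff'[of "pow g i" f] f g by simp
  then have "len f \<le> len ?a + len g * i"
    using len_pow_linear[of i] by linarith
  then have "real (len f) \<le> real (len ?a) + real (len g) * real i"
    by (simp flip: of_nat_mult of_nat_add)
  then have "N \<le> \<epsilon> * (N + real i) + real (len g) * real i"
    using N i by linarith
  \<comment> \<open>Multiplication by \<epsilon> turns \<open>len g\<close> into
    \<open>\<delta> / 8\<close>, so that the estimate can be compared with inequality 1.\<close>
  then have "\<epsilon> * N \<le> \<epsilon> * (\<epsilon> * (N + real i) + real (len g) * real i)"
    using eps(1) by (intro mult_left_mono) auto
  also have "\<dots> = \<epsilon> * (\<epsilon> * N) + \<epsilon> * (\<epsilon> * real i) + \<epsilon> * real (len g) * real i"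
    by (simp add: algebra_simps)
  also have "\<dots> \<le> 1 / 8 * (\<epsilon> * N) + 1 / 8 * (\<epsilon> * real i) + \<delta> / 8 * real i"
    unfolding eps(2) using eps(1,3) N by (intro add_mono mult_right_mono) auto
  finally have 2: "7 * (\<epsilon> * N) \<le> \<epsilon> * real i + \<delta> * real i"
    by simp
  have "8 * \<epsilon> * real i \<le> \<delta> * real i" "8 * \<epsilon> * real j \<le> \<delta> * real j" "0 \<le> \<delta> * real j" "0 \<le> \<delta> * real i"
    using eps(4) delta by (auto intro!: mult_right_mono)
  with 1 2 show False
    by (simp add: distrib_left)
qed

text \<open>The constants are fixed before \<open>k\<close>. This uniformity is what lets the
  transfer function extend from finitely supported changes to all configurations.\<close>

lemma Theta_bound:
  obtains K q where "K > 0" "0 < q" "q < 1"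
    "\<And>n k x y. \<lbrakk>x \<in> X; y \<in> X; agree_off G S k x y; \<And>f. f \<in> word_ball G S n \<Longrightarrow> x f = y f\<rbrakk> \<Longrightarrow>
      d (\<Theta> x y) \<one>\<^bsub>H\<^esub> \<le> K * q ^ n"
proof -
  define q where "q = r powr \<epsilon>"
  define K where "K = 2 * (C / r * q / (1 - q))"
  have q: "0 < q" "q < 1"
    using r eps(1) by (auto simp: q_def powr01_less_one)
  have K: "K > 0"
    using q C r by (simp add: K_def)
  have *: "d (\<Theta> x y) \<one>\<^bsub>H\<^esub> \<le> K * q ^ n"
    if x: "x \<in> X" "y \<in> X" "agree_off G S k x y" and eq: "\<And>f. f \<in> word_ball G S n \<Longrightarrow> x f = y f"
    for n k x y
  proof -
    \<comment> \<open>A coordinate outside the ball of radius \<open>n\<close> has length at least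
      \<open>n + 1\<close>.\<close>
    define N where "N = real (Suc n)"
    define P where "P f \<longleftrightarrow> (\<forall>i. \<epsilon> * (N + real i) \<le> real (len (pow g i \<otimes>\<^bsub>G\<^esub> f)))" for f
    \<comment> \<open>The intermediate configuration: \<open>x\<close> and \<open>z\<close> differ
      only far from the ray used in \<open>P\<close>, while \<open>z\<close> and \<open>y\<close>
      differ only where \<open>P\<close> fails, hence far from the other ray.\<close>
    define z where "z = (\<lambda>f\<in>carrier G. if P f then y f else x f)"
    have z: "z \<in> X"
      using x by (auto simp: z_def full_shift_def)
    have off: "agree_off G S k x z" "agree_off G S k z y"
      using x(3) by (auto simp: agree_off_def z_def)
    have N: "N > 0" by (simp add: N_def)
    have far: "P f \<or> (\<forall>j. \<epsilon> * (N + real j) \<le> real (len (pow (inv\<^bsub>G\<^esub> g) j \<otimes>\<^bsub>G\<^esub> f)))"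
      if "f \<in> carrier G" "x f \<noteq> y f" for f
    proof -
      have "f \<notin> word_ball G S n"
        using that eq by blast
      then have "n < len f"
        using that by (simp add: word_ball_def)
      then show ?thesis
        unfolding P_def using that N by (intro far_from_a_ray) (auto simp: N_def)
    qed
    have powN: "r powr (\<epsilon> * N) = q * q ^ n"
      using r by (simp add: q_def N_def powr_power algebra_simps flip: powr_add)
    have "d (\<Theta> x z) \<one>\<^bsub>H\<^esub> \<le> C / r * r powr (\<epsilon> * N) / (1 - r powr \<epsilon>)"
      by (rule ray_bound[OF x(1) z _ Theta_limit[OF x(1) z off(1)] eps(1) N])
        (auto simp: z_def P_def split: if_splits)
    moreover have "d (\<Theta> z y) \<one>\<^bsub>H\<^esub> \<le> C / r * r powr (\<epsilon> * N) / (1 - r powr \<epsilon>)"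
      by (rule ray_bound[OF z x(2) _ Theta_limit_inverse[OF z x(2) off(2)] eps(1) N])
        (use far in \<open>auto simp: z_def split: if_splits\<close>)
    moreover have "d (\<Theta> x y) \<one>\<^bsub>H\<^esub> \<le> d (\<Theta> x z) \<one>\<^bsub>H\<^esub> + d (\<Theta> z y) \<one>\<^bsub>H\<^esub>"
      using H.dist_mult[of "\<Theta> x z" "\<Theta> z y" "\<one>\<^bsub>H\<^esub>" "\<one>\<^bsub>H\<^esub>"]
        Theta_closed[OF x(1) z off(1)] Theta_closed[OF z x(2) off(2)]
      by (simp add: Theta_trans[OF x(1) z x(2) off x(3)])
    ultimately have "d (\<Theta> x y) \<one>\<^bsub>H\<^esub> \<le> 2 * (C / r * (q * q ^ n) / (1 - q))"
      unfolding powN q_def[symmetric] by linarith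
    then show ?thesis
      by (simp add: K_def mult.assoc)
  qed
  show thesis
    by (rule that[OF K q], rule *) assumption+
qed

section \<open>Extension to all configurations and the cohomology equation\<close>

lemma cohomologous_to_hom:
  assumes a0: "a0 \<in> A"
  shows "\<exists>\<phi>\<in>hom G H. hoelder_cohomologous G S A H d c (\<lambda>h _. \<phi> h)"
proof -
  obtain K q where Kq: "K > 0" "0 < q" "q < 1"
    and bound: "\<And>n k x y. \<lbrakk>x \<in> X; y \<in> X; agree_off G S k x y; \<And>f. f \<in> word_ball G S n \<Longrightarrow> x f = y f\<rbrakk> \<Longrightarrow>
      d (\<Theta> x y) \<one>\<^bsub>H\<^esub> \<le> K * q ^ n"
    using Theta_bound by metis
  \<comment> \<open>A constant configuration is fixed by the shift, so the cocycle identity at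
    \<open>x0\<close> is multiplicativity.\<close>
  define x0 where "x0 = (\<lambda>f\<in>carrier G. a0)"
  \<comment> \<open>Truncations agree with \<open>x0\<close> off a ball, so \<beta> can be evaluated
    on them.\<close>
  define tr where "tr n x = (\<lambda>f\<in>carrier G. if len f \<le> n then x f else a0)" for n and x :: "'g \<Rightarrow> 'a"
  define \<beta> where "\<beta> = \<Theta> x0"
  have x0: "x0 \<in> X"
    using a0 by (auto simp: x0_def full_shift_def)
  have act_x0: "act h x0 = x0" if "h \<in> carrier G" for h
    using that by (auto simp: shift_def x0_def fun_eq_iff)
  have tr: "tr n x \<in> X" if "x \<in> X" for n x
    using that a0 by (auto simp: tr_def full_shift_def)
  have off_tr: "agree_off G S n x0 (tr n x)" for n x
    by (auto simp: agree_off_def x0_def tr_def)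
  have beta_closed: "\<beta> x \<in> carrier H" if "x \<in> X" "agree_off G S k x0 x" for x k
    using that Theta_closed[OF x0] by (auto simp: \<beta>_def)
  \<comment> \<open>By \<open>Theta_trans\<close> and left invariance this distance is that of
    \<open>\<Theta> x y\<close> from the identity; the radii \<open>k\<close> and \<open>l\<close>
    leave no trace in the bound.\<close>
  have beta_dist: "d (\<beta> x) (\<beta> y) \<le> K * q ^ n"
    if x: "x \<in> X" "y \<in> X" and off: "agree_off G S k x0 x" "agree_off G S l x0 y"
      and eq: "\<And>f. f \<in> word_ball G S n \<Longrightarrow> x f = y f" for x y k l n
  proof -
    have off': "agree_off G S (max k l) x0 x" "agree_off G S (max k l) x y" "agree_off G S (max k l) x0 y"
      using off by (auto simp: agree_off_def)
    have cl: "\<beta> x \<in> carrier H" "\<Theta> x y \<in> carrier H"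
      using beta_closed x off Theta_closed[OF x off'(2)] by auto
    have "\<beta> y = \<beta> x \<otimes>\<^bsub>H\<^esub> \<Theta> x y"
      unfolding \<beta>_def using x x0 off' by (intro Theta_trans[symmetric]) auto
    then have "d (\<beta> x) (\<beta> y) = d \<one>\<^bsub>H\<^esub> (\<Theta> x y)"
      using cl H.left_invariant[of "\<one>\<^bsub>H\<^esub>" "\<Theta> x y" "\<beta> x"] by simp
    with bound[OF x off'(2) eq] show ?thesis by (simp add: H.commute)
  qed
  \<comment> \<open>Consecutive truncations agree on growing balls, so \<open>beta_dist\<close>
    makes their \<beta>-values a geometrically Cauchy sequence.\<close>
  define b where "b x = (SOME l. converges (\<lambda>n. \<beta> (tr n x)) l)" for x
  have beta_tr: "\<beta> (tr n x) \<in> carrier H" if "x \<in> X" for n x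
    using that tr off_tr beta_closed by blast
  have b_lim: "converges (\<lambda>n. \<beta> (tr n x)) (b x)" if "x \<in> X" for x
  proof -
    have "\<exists>l. converges (\<lambda>n. \<beta> (tr n x)) l"
    proof (rule H.geometric_converges[OF H.complete, where k = 0])
      show "d (\<beta> (tr n x)) (\<beta> (tr (Suc n) x)) \<le> K * q ^ n" for n
        using that by (intro beta_dist[OF _ _ off_tr off_tr] tr) (auto simp: tr_def word_ball_def)
    qed (use Kq beta_tr that in auto)
    then show ?thesis
      unfolding b_def by (rule someI_ex)
  qed
  have b_closed: "b x \<in> carrier H" if "x \<in> X" for x
    using b_lim[OF that] by (simp add: H.limitin_metric_dist_null)
  have b_dist: "d (b x) (b y) \<le> K * q ^ n"
    if x: "x \<in> X" "y \<in> X" and eq: "\<And>f. f \<in> word_ball G S n \<Longrightarrow> x f = y f" for x y n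
  proof (rule H.limitin_dist_le[OF b_lim[OF x(1)] b_lim[OF x(2)]])
    show "d (\<beta> (tr m x)) (\<beta> (tr m y)) \<le> K * q ^ n" for m
      using x eq by (intro beta_dist[OF _ _ off_tr off_tr] tr) (auto simp: tr_def)
  qed (use beta_tr x in auto)
  have hom: "(\<lambda>h. c h x0) \<in> hom G H"
    using x0 by (auto simp: hom_def c_mult act_x0)
  have cohom: "c h x = inv\<^bsub>H\<^esub> (b (act h x)) \<otimes>\<^bsub>H\<^esub> c h x0 \<otimes>\<^bsub>H\<^esub> b x"
    if h: "h \<in> carrier G" and x: "x \<in> X" for h x
  proof -
    have off: "agree_off G S (n + len h) x0 (act h (tr n x))" for n
      using agree_off_act[OF x0 tr[OF x] off_tr h] h by (simp add: act_x0)
    have cl: "\<beta> (act h (tr n x)) \<in> carrier H" for n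
      using beta_closed[OF _ off] tr x h by simp
    \<comment> \<open>The cohomology equation already holds on truncations, as a rearrangement of
      \<open>Theta_act\<close> with \<open>x0\<close> fixed by \<open>h\<close>.\<close>
    have eq: "c h (tr n x) = inv\<^bsub>H\<^esub> (\<beta> (act h (tr n x))) \<otimes>\<^bsub>H\<^esub> c h x0 \<otimes>\<^bsub>H\<^esub> \<beta> (tr n x)" for n
    proof -
      let ?B = "\<beta> (act h (tr n x))" and ?\<phi> = "c h x0" and ?c = "c h (tr n x)"
      have in_H: "?\<phi> \<in> carrier H" "?c \<in> carrier H" "?B \<in> carrier H"
        using cl h x0 tr[OF x] by auto
      have "\<beta> (tr n x) = inv\<^bsub>H\<^esub> ?\<phi> \<otimes>\<^bsub>H\<^esub> ?B \<otimes>\<^bsub>H\<^esub> ?c"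
        unfolding \<beta>_def using Theta_act[OF x0 tr[OF x] off_tr h] h by (simp add: act_x0)
      also have "\<dots> = inv\<^bsub>H\<^esub> ?\<phi> \<otimes>\<^bsub>H\<^esub> (?B \<otimes>\<^bsub>H\<^esub> ?c)"
        using in_H by (simp add: H.m_assoc)
      finally have "?\<phi> \<otimes>\<^bsub>H\<^esub> \<beta> (tr n x) = ?B \<otimes>\<^bsub>H\<^esub> ?c"
        using in_H by (simp flip: H.m_assoc)
      then show ?thesis
        using in_H beta_tr[OF x] by (simp add: H.m_assoc H.inv_solve_left)
    qed
    have lim_b: "converges (\<lambda>n. \<beta> (act h (tr n x))) (b (act h x))"
    proof (rule H.limitin_close[OF b_lim])
      \<comment> \<open>Truncation and shift do not commute, since \<open>act h (tr n x)\<close> is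
        cut off on a translate of the ball. On the ball of radius \<open>n - len h\<close> both
        still coincide with \<open>act h x\<close>.\<close>
      have "d (\<beta> (tr n (act h x))) (\<beta> (act h (tr n x))) \<le> K * q ^ (n - len h)" if "len h \<le> n" for n
      proof (rule beta_dist[OF _ _ off_tr off])
        fix f
        assume "f \<in> word_ball G S (n - len h)"
        then have f: "f \<in> carrier G" "len f \<le> n - len h"
          by (auto simp: word_ball_def)
        have "len (inv\<^bsub>G\<^esub> h \<otimes>\<^bsub>G\<^esub> f) \<le> n"
          using G.len_mult[of "inv\<^bsub>G\<^esub> h" f] f h that by simp
        moreover have "len f \<le> n"
          using f by simp
        ultimately show "tr n (act h x) f = act h (tr n x) f"
          using f h that by (simp add: tr_def shift_def)
      qed (use tr x h in auto)
      then have le: "\<forall>\<^sub>F n in sequentially. d (\<beta> (tr n (act h x))) (\<beta> (act h (tr n x))) \<le> K * q ^ (n - len h)"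
        using eventually_ge_at_top[of "len h"] by (rule eventually_mono[rotated])
      have "(\<lambda>n. K * q ^ (n - len h)) \<longlonglongrightarrow> K * 0"
        by (intro tendsto_mult tendsto_const filterlim_compose[OF LIMSEQ_power_zero filterlim_minus_const_nat_at_top])
          (use Kq in auto)
      then show "(\<lambda>n. d (\<beta> (tr n (act h x))) (\<beta> (act h (tr n x)))) \<longlonglongrightarrow> 0"
        by (intro tendsto_sandwich[OF _ le tendsto_const]) auto
    qed (use h x cl beta_tr in auto)
    have lim_c: "converges (\<lambda>n. c h (tr n x)) (c h x)"
    proof -
      \<comment> \<open>The constants \<open>C\<close>, \<open>r\<close> cover only
        \<open>S\<close>, \<open>g\<close> and its inverse; a general \<open>h\<close> brings its
        own.\<close>
      obtain C' r' where Cr: "C' > 0" "0 < r'" "r' < 1"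
        and ho: "\<And>n y z. \<lbrakk>y \<in> X; z \<in> X; \<forall>f\<in>word_ball G S n. y f = z f\<rbrakk> \<Longrightarrow> d (c h y) (c h z) \<le> C' * r' ^ n"
        using hoelder_coc h unfolding hoelder_cocycle_def hoelder_continuous_def by blast
      have "(\<lambda>n. C' * r' ^ n) \<longlonglongrightarrow> C' * 0"
        using Cr by (intro tendsto_mult tendsto_const LIMSEQ_power_zero) auto
      then have lim: "(\<lambda>n. C' * r' ^ n) \<longlonglongrightarrow> 0" by simp
      have "d (c h (tr n x)) (c h x) \<le> C' * r' ^ n" for n
        using x by (intro ho tr) (auto simp: tr_def word_ball_def)
      then have "(\<lambda>n. d (c h (tr n x)) (c h x)) \<longlonglongrightarrow> 0"
        by (intro tendsto_sandwich[OF _ _ tendsto_const lim] always_eventually) auto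
      then show ?thesis
        using h x tr by (simp add: H.limitin_metric_dist_null)
    qed
    have "converges (\<lambda>n. inv\<^bsub>H\<^esub> (\<beta> (act h (tr n x))) \<otimes>\<^bsub>H\<^esub> c h x0 \<otimes>\<^bsub>H\<^esub> \<beta> (tr n x))
        (inv\<^bsub>H\<^esub> (b (act h x)) \<otimes>\<^bsub>H\<^esub> c h x0 \<otimes>\<^bsub>H\<^esub> b x)"
      using h x x0 cl beta_tr
      by (intro H.limitin_mult H.limitin_inv H.limitin_const_seq lim_b b_lim) simp_all
    then have "converges (\<lambda>n. c h (tr n x)) (inv\<^bsub>H\<^esub> (b (act h x)) \<otimes>\<^bsub>H\<^esub> c h x0 \<otimes>\<^bsub>H\<^esub> b x)"
      by (simp only: eq)
    with lim_c show ?thesis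
      using H.limitin_metric_unique trivial_limit_sequentially by blast
  qed
  have hc_b: "hoelder_continuous G S A d b"
    unfolding hoelder_continuous_def
  proof (rule exI[of _ K], rule exI[of _ q], intro conjI allI ballI impI Kq)
    show "d (b x) (b y) \<le> K * q ^ n"
      if "x \<in> X" "y \<in> X" "\<forall>h\<in>word_ball G S n. x h = y h" for n x y
      using that by (intro b_dist) auto
  qed
  have "hoelder_cohomologous G S A H d c (\<lambda>h _. c h x0)"
    unfolding hoelder_cohomologous_def
    by (rule exI[of _ b], intro conjI ballI b_closed hc_b cohom)
  with hom show ?thesis by (rule bexI[where x = "\<lambda>h. c h x0", rotated])
qed

end

section \<open>Common Hoelder constants and the final assembly\<close>

lemma hoelder_uniform:
  assumes "finite T" and "\<forall>s\<in>T. hoelder_continuous G S A d (c s)"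
  shows "\<exists>C r. C > 0 \<and> 0 < r \<and> r < 1 \<and> (\<forall>s\<in>T. \<forall>n. \<forall>x\<in>full_shift G A. \<forall>y\<in>full_shift G A.
    (\<forall>h\<in>word_ball G S n. x h = y h) \<longrightarrow> d (c s x) (c s y) \<le> C * r ^ n)"
  using assms
proof (induction T rule: finite_induct)
  case empty
  show ?case by (rule exI[of _ 1], rule exI[of _ "1/2"]) simp
next
  case (insert s T)
  then obtain C r where 1: "C > 0" "0 < r" "r < 1"
    "\<And>s n x y. \<lbrakk>s \<in> T; x \<in> full_shift G A; y \<in> full_shift G A; \<forall>h\<in>word_ball G S n. x h = y h\<rbrakk>
      \<Longrightarrow> d (c s x) (c s y) \<le> C * r ^ n"
    by (auto simp: Ball_def)
  obtain C' r' where 2: "C' > 0" "0 < r'" "r' < 1"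
    "\<And>n x y. \<lbrakk>x \<in> full_shift G A; y \<in> full_shift G A; \<forall>h\<in>word_ball G S n. x h = y h\<rbrakk>
      \<Longrightarrow> d (c s x) (c s y) \<le> C' * r' ^ n"
    using insert.prems unfolding hoelder_continuous_def by auto
  have mono: "C * r ^ n \<le> max C C' * max r r' ^ n" "C' * r' ^ n \<le> max C C' * max r r' ^ n" for n
    using 1 2 by (auto intro!: mult_mono power_mono)
  show ?case
  proof (rule exI[of _ "max C C'"], rule exI[of _ "max r r'"], intro conjI ballI allI impI)
    fix t n x y
    assume t: "t \<in> insert s T"
      and xy: "x \<in> full_shift G A" "y \<in> full_shift G A" "\<forall>h\<in>word_ball G S n. x h = y h"
    show "d (c t x) (c t y) \<le> max C C' * max r r' ^ n"
    proof (cases "t = s")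
      case True
      then show ?thesis
        using order_trans[OF 2(4)[OF xy] mono(2)] by simp
    next
      case False
      with t show ?thesis
        using order_trans[OF 1(4)[OF _ xy] mono(1)] by simp
    qed
  qed (use 1 2 in auto)
qed

theorem corollary1p2:
  fixes G :: "('g, 'm) monoid_scheme" and S :: "'g set"
  assumes "group G"
    and "infinite (carrier G)"
    and "finite_symmetric_generating_set G S"
    and "one_ended G S"
    and "\<exists>g. undistorted G S g"
    and "subexponential_divergence G S"
  shows "in_class_GH TYPE('a) TYPE('h) G S"
  unfolding in_class_GH_def
proof (intro allI impI)
  fix A :: "'a set" and H :: "'h monoid" and T d c
  assume "finite A \<and> polish_group H T \<and> biinvariant_metric H T d"
  then have H: "group H" and bi: "biinvariant_metric H T d"
    by (auto simp: polish_group_def)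
  assume coc: "hoelder_cocycle G S A H d c"
  interpret G: word_metric G S
    using assms(1,3) by (simp add: word_metric_def word_metric_axioms_def)
  interpret H: group H by (fact H)
  show "\<exists>\<phi>\<in>hom G H. hoelder_cohomologous G S A H d c (\<lambda>g _. \<phi> g)"
  proof (cases "A = {}")
    \<comment> \<open>Without a letter there is no constant configuration, but the full shift is
      then empty and every condition on configurations is vacuous.\<close>
    case True
    then have empty: "full_shift G A = {}"
      using G.one_closed by (auto simp: full_shift_def PiE_eq_empty_iff)
    have "(\<lambda>_. \<one>\<^bsub>H\<^esub>) \<in> hom G H"
      by (simp add: hom_def)
    moreover have "hoelder_cohomologous G S A H d c (\<lambda>g _. \<one>\<^bsub>H\<^esub>)"
      unfolding hoelder_cohomologous_def hoelder_continuous_def empty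
      by (auto intro!: exI[of _ "1::real"] exI[of _ "1/2::real"])
    ultimately show ?thesis by (intro bexI[where x = "\<lambda>_. \<one>\<^bsub>H\<^esub>"])
  next
    case False
    then obtain a0 where a0: "a0 \<in> A" by blast
    obtain g where und: "undistorted G S g"
      using assms(5) by blast
    then have g: "g \<in> carrier G" by (simp add: undistorted_def)
    obtain \<delta> where \<delta>: "\<delta> > 0" "\<And>n::nat. \<delta> * real n \<le> real (word_length G S (g [^]\<^bsub>G\<^esub> n))"
      by (rule G.undistorted_linear[OF und]) blast
    have fin: "finite (insert g (insert (inv\<^bsub>G\<^esub> g) S))"
      using G.finite_S by simp
    have hc: "\<forall>s\<in>insert g (insert (inv\<^bsub>G\<^esub> g) S). hoelder_continuous G S A d (c s)"
      using coc g G.S_carrier by (auto simp: hoelder_cocycle_def)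
    obtain C r where Cr: "C > 0" "0 < r" "r < 1"
      and step: "\<forall>s\<in>insert g (insert (inv\<^bsub>G\<^esub> g) S). \<forall>n. \<forall>x\<in>full_shift G A. \<forall>y\<in>full_shift G A.
        (\<forall>h\<in>word_ball G S n. x h = y h) \<longrightarrow> d (c s x) (c s y) \<le> C * r ^ n"
      using hoelder_uniform[OF fin hc] by (elim exE conjE) (rule that)
    interpret H: biinvariant_group H d
      using bi H by (auto simp: biinvariant_group_def biinvariant_group_axioms_def biinvariant_metric_def)
    interpret shift_cocycle G S H d A c g \<delta> C r
    proof (unfold_locales, fact coc, fact assms(6), fact g, fact \<delta>(1), fact \<delta>(2),
        fact Cr(1), fact Cr(2), fact Cr(3))
      fix s n x y
      assume "s \<in> insert g (insert (inv\<^bsub>G\<^esub> g) S)" "x \<in> full_shift G A" "y \<in> full_shift G A"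
        and "\<And>h. h \<in> word_ball G S n \<Longrightarrow> x h = y h"
      then show "d (c s x) (c s y) \<le> C * r ^ n"
        by (intro step[rule_format]) simp_all
    qed
    show ?thesis by (rule cohomologous_to_hom[OF a0])
  qed
qed

end
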